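(* Let $(\mathcal{X},\rho,\nu)$ be a bounded length space with finite doubling dimension, equipped with a finite Borel measure $\nu$. Suppose the concept $c$ satisfies $\nu(\partial\mathcal{X})=0$, and let the adversary be $\sigma$-smooth for some $\sigma>0$. Let $d=d(\partial\mathcal{X})$ be the box-counting dimension and $\mathfrak{m}=\mathfrak{m}(\partial\mathcal{X})$ the (finite) Minkowski content of the boundary, and assume $d>1$. Then for any $c_1,c_2,p>0$ there exist constants $C_0,C_1>0$ such that with probability at least $1-p$ the 1-nearest neighbor rule satisfies, simultaneously for all $T\in\mathbb{N}$, $$\#\mathrm{mistakes}_T\le C_0+C_1\left(\frac{(\mathfrak{m}+c_2)T}{\sigma}\right)^{(d+c_1)/(d+1)}.$$
   Context: Length space: $\rho(x,x')$ equals the infimum of lengths of continuous paths from $x$ to $x'$. $\mathcal{N}_r(A)$ is the minimal number of radius-$r$ balls covering $A$. Doubling dimension $\Gamma$: there is $C>0$ with $\mathcal{N}_{r/2}(B(x,r))\le C2^\Gamma$ for all $r>0$, $x\in\mathcal{X}$; finite doubling dimension means some finite $\Gamma$ works. Box-counting dimension: $d(A)=\limsup_{r\to0}\log\mathcal{N}_r(A)/\log(1/r)$. $r$-expansion: $A^r=\bigcup_{x\in A}B(x,r)$. Minkowski content: $\mathfrak{m}(A)=\limsup_{r\to0}(\nu(A^r)-\nu(A))/r$. Margin $m_c(x)=\inf_{x':c(x')\ne c(x)}\rho(x,x')$, $\partial\mathcal{X}=\{x:m_c(x)=0\}$. Protocol: at each $t$ the adversary picks a distribution $\mu_t$ (possibly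 history-dependent), draws $x_t\sim\mu_t$; 1-nearest neighbor predicts $\hat y_t=c(x_{\mathrm{NN}_t})$, $\mathrm{NN}_t\in\arg\min_{\tau<t}\rho(x_t,x_\tau)$ (ties arbitrary); $\#\mathrm{mistakes}_T=\sum_{t\le T}\mathbb{1}\{\hat y_t\ne c(x_t)\}$. The adversary is $\sigma$-smooth if every distribution $\mu$ it selects satisfies $\mu(A)\le\nu(A)/\sigma$ for all measurable $A$. *)

theory Defs
  imports "HOL-Probability.Probability"
begin

definition curve_length :: "(real \<Rightarrow> 'a::metric_space) \<Rightarrow> ereal" where
  "curve_length \<gamma> =
     (SUP nt \<in> {(n, t). t 0 = (0::real) \<and> t n = 1 \<and> (\<forall>i<n. t i \<le> t (Suc i))}.
        ereal (\<Sum>i<fst nt. dist (\<gamma> (snd nt i)) (\<gamma> (snd nt (Suc i)))))"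

definition length_space :: "'a::metric_space itself \<Rightarrow> bool" where
  "length_space _ \<longleftrightarrow> (\<forall>x y::'a. ereal (dist x y) =
     (INF \<gamma> \<in> {\<gamma>. continuous_on {0..1} \<gamma> \<and> \<gamma> 0 = x \<and> \<gamma> 1 = y}. curve_length \<gamma>))"

definition covering_number :: "real \<Rightarrow> 'a::metric_space set \<Rightarrow> ereal" where
  "covering_number r A =
     (INF S \<in> {S. finite S \<and> A \<subseteq> (\<Union>x\<in>S. ball x r)}. ereal (real (card S)))"

definition finite_doubling_dimension :: "'a::metric_space itself \<Rightarrow> bool" where
  "finite_doubling_dimension _ \<longleftrightarrow> (\<exists>\<Gamma>::real. \<exists>C>0. \<forall>(x::'a) r. r > 0 \<longrightarrow>
      covering_number (r/2) (ball x r) \<le> ereal (C * 2 powr \<Gamma>))"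

definition box_dim :: "'a::metric_space set \<Rightarrow> ereal" where
  "box_dim A = Limsup (at_right (0::real))
     (\<lambda>r. if covering_number r A = \<infinity> then \<infinity>
          else ereal (ln (real_of_ereal (covering_number r A)) / ln (1 / r)))"

definition expansion :: "'a::metric_space set \<Rightarrow> real \<Rightarrow> 'a set" where
  "expansion A r = (\<Union>x\<in>A. ball x r)"

definition minkowski_content :: "'a::metric_space measure \<Rightarrow> 'a set \<Rightarrow> ereal" where
  "minkowski_content \<nu> A = Limsup (at_right (0::real))
     (\<lambda>r. ereal ((measure \<nu> (expansion A r) - measure \<nu> A) / r))"

definition margin :: "('a::metric_space \<Rightarrow> 'b) \<Rightarrow> 'a \<Rightarrow> ereal" where
  "margin c x = (INF x' \<in> {x'. c x' \<noteq> c x}. ereal (dist x x'))"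

definition boundary :: "('a::metric_space \<Rightarrow> 'b) \<Rightarrow> 'a set" where
  "boundary c = {x. margin c x = 0}"

text \<open>An adversary is a map from the history (list of past points) to a distribution;
  it is sigma-smooth w.r.t. nu.\<close>
definition smooth_adversary ::
    "'a::metric_space measure \<Rightarrow> real \<Rightarrow> ('a list \<Rightarrow> 'a measure) \<Rightarrow> bool" where
  "smooth_adversary \<nu> \<sigma> \<mu> \<longleftrightarrow> (\<forall>h. prob_space (\<mu> h) \<and> sets (\<mu> h) = sets borel \<and>
      (\<forall>A \<in> sets borel. measure (\<mu> h) A \<le> measure \<nu> A / \<sigma>))"

definition history :: "(nat \<Rightarrow> 'w \<Rightarrow> 'a) \<Rightarrow> nat \<Rightarrow> 'w \<Rightarrow> 'a list" where
  "history X t \<omega> = map (\<lambda>i. X i \<omega>) [0..<t]"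

text \<open>X is a realisation on the probability space M of the adaptive protocol:
  the conditional law of X t given X 0, ..., X (t-1) is mu (history).\<close>
definition adaptive_process ::
    "'w measure \<Rightarrow> ('a::metric_space list \<Rightarrow> 'a measure) \<Rightarrow> (nat \<Rightarrow> 'w \<Rightarrow> 'a) \<Rightarrow> bool" where
  "adaptive_process M \<mu> X \<longleftrightarrow> prob_space M \<and> (\<forall>t. X t \<in> measurable M borel) \<and>
     (\<forall>t A F. A \<in> sets borel \<longrightarrow>
        F \<in> sigma_sets (space M) (\<Union>i<t. {X i -` B \<inter> space M | B. B \<in> sets borel}) \<longrightarrow>
        emeasure M (F \<inter> (X t -` A \<inter> space M)) =
          (\<integral>\<^sup>+ \<omega>. indicator F \<omega> * emeasure (\<mu> (history X t \<omega>)) A \<partial>M))"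

definition valid_nn_rule :: "('a::metric_space list \<Rightarrow> 'a \<Rightarrow> nat) \<Rightarrow> bool" where
  "valid_nn_rule nn \<longleftrightarrow> (\<forall>hs x. hs \<noteq> [] \<longrightarrow> nn hs x < length hs \<and>
      (\<forall>j < length hs. dist x (hs ! nn hs x) \<le> dist x (hs ! j)))"

text \<open>Mistake at round t (rounds indexed from 0; the first round, with no past
  point, is counted as a mistake).\<close>
definition nn_mistake :: "('a::metric_space \<Rightarrow> 'b) \<Rightarrow> ('a list \<Rightarrow> 'a \<Rightarrow> nat) \<Rightarrow> (nat \<Rightarrow> 'a) \<Rightarrow> nat \<Rightarrow> bool" where
  "nn_mistake c nn xs t \<longleftrightarrow> t = 0 \<or> c (xs (nn (map xs [0..<t]) (xs t))) \<noteq> c (xs t)"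

definition num_mistakes :: "('a::metric_space \<Rightarrow> 'b) \<Rightarrow> ('a list \<Rightarrow> 'a \<Rightarrow> nat) \<Rightarrow> (nat \<Rightarrow> 'a) \<Rightarrow> nat \<Rightarrow> nat" where
  "num_mistakes c nn xs T = card {t. t < T \<and> nn_mistake c nn xs t}"

end

theory Submission
  imports Defs
begin

text \<open>In a length space every path joining differently labelled points meets the boundary, so a
  mistake made at distance at least \<open>r\<close> from the boundary is \<open>r\<close>-separated from all earlier points.
  Hence, at any time horizon, the mistakes at distance between \<open>s / 2\<close> and \<open>s\<close> from the boundary
  number at most a constant times the covering number of the boundary at scale \<open>s\<close>; summing over
  \<open>s = 2\<^sup>-\<^sup>k\<close> with \<open>k < K\<close> gives a geometric sum of order \<open>2 powr (K * (d + c1))\<close>. The points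
  closer than \<open>2\<^sup>-\<^sup>K\<close> to the boundary are all treated as mistakes; by smoothness and finite Minkowski
  content each round produces one with probability \<open>O(2\<^sup>-\<^sup>K)\<close>. Both contributions balance for horizons
  \<open>T\<close> of order \<open>2 powr (K * (d + 1))\<close>.\<close>

section \<open>Labels, curves and the boundary in a length space\<close>

lemma locally_constant_off_boundary:
  assumes "z \<notin> boundary c"
  shows "\<exists>e>0. \<forall>y. dist z y < e \<longrightarrow> c y = c z"
proof -
  have "margin c z \<ge> 0" unfolding margin_def by (intro INF_greatest) auto
  with assms have "0 < margin c z" unfolding boundary_def by auto
  then obtain e where e: "0 < ereal e" "ereal e < margin c z" using ereal_dense2 by blast
  have "c y = c z" if "dist z y < e" for y
  proof (rule ccontr)
    assume "c y \<noteq> c z"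
    then have "margin c z \<le> ereal (dist z y)" unfolding margin_def by (intro INF_lower) auto
    with e(2) have "ereal e < ereal (dist z y)" by (rule less_le_trans)
    with that show False by simp
  qed
  moreover have "e > 0" using e(1) by simp
  ultimately show ?thesis by blast
qed

text \<open>The partition \<open>0, s, 1\<close> takes part in the supremum, and its second segment
  has nonnegative length.\<close>

lemma dist_le_curve_length:
  assumes "s \<in> {0..1}"
  shows "ereal (dist (\<gamma> 0) (\<gamma> s)) \<le> curve_length \<gamma>"
proof -
  define t where "t = (\<lambda>i::nat. if i = 0 then 0 else if i = 1 then s else 1)"
  have "ereal (\<Sum>i<fst (2::nat, t). dist (\<gamma> (snd (2::nat, t) i)) (\<gamma> (snd (2::nat, t) (Suc i))))
    \<le> curve_length \<gamma>"
    unfolding curve_length_def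
    by (rule SUP_upper) (use assms in \<open>auto simp: t_def less_2_cases_iff\<close>)
  then have "ereal (dist (\<gamma> 0) (\<gamma> s) + dist (\<gamma> s) (\<gamma> 1)) \<le> curve_length \<gamma>"
    by (simp add: t_def numeral_2_eq_2)
  then show ?thesis
    by (rule order_trans[rotated]) simp
qed

text \<open>Off the boundary labels are locally constant, so a curve avoiding it would have a single
  label on its whole connected image.\<close>

lemma path_meets_boundary:
  fixes \<gamma> :: "real \<Rightarrow> 'a::metric_space"
  assumes "continuous_on {0..1} \<gamma>" and "c (\<gamma> 0) \<noteq> c (\<gamma> 1)"
  shows "\<exists>s\<in>{0..1}. \<gamma> s \<in> boundary c"
proof (rule ccontr)
  assume no: "\<not> ?thesis"
  have conn: "connected (\<gamma> ` {0..1})"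
    using assms(1) by (intro connected_continuous_image) auto
  have "c (\<gamma> 0) = c (\<gamma> 1)"
  proof (rule connected_equivalence_relation_gen
      [where S = "\<gamma> ` {0..1}" and P = "\<lambda>_. True" and R = "\<lambda>x y. c x = c y"])
    show "\<exists>T. openin (top_of_set (\<gamma> ` {0..1})) T \<and> a \<in> T \<and>
        (\<forall>x\<in>T. \<forall>y\<in>T. True \<and> True \<longrightarrow> c x = c y)" if "a \<in> \<gamma> ` {0..1}" for a
    proof -
      from that no have "a \<notin> boundary c" by auto
      from locally_constant_off_boundary[OF this]
      obtain e where e: "e > 0" "\<forall>y. dist a y < e \<longrightarrow> c y = c a" by blast
      have "\<forall>x\<in>ball a e. \<forall>y\<in>ball a e. c x = c y" using e(2) by (metis mem_ball)
      moreover have "a \<in> ball a e" using e(1) by simp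
      ultimately show ?thesis using that
        by (intro exI[of _ "\<gamma> ` {0..1} \<inter> ball a e"] conjI openin_open_Int open_ball) blast+
    qed
  qed (use conn in \<open>auto simp: openin_contains_ball\<close>)
  with assms(2) show False by simp
qed

text \<open>No shortest curve need exist, but some curve from \<open>x\<close> to \<open>y\<close>
  has length below \<open>r\<close>. All of its points lie within \<open>r\<close> of
  \<open>x\<close>, and one of them is on the boundary.\<close>

lemma length_space_boundary_between:
  fixes x y :: "'a::metric_space"
  assumes "length_space TYPE('a)" and "c x \<noteq> c y" and "dist x y < r"
  shows "x \<in> expansion (boundary c) r"
proof -
  have "(INF \<gamma> \<in> {\<gamma>. continuous_on {0..1} \<gamma> \<and> \<gamma> 0 = x \<and> \<gamma> 1 = y}. curve_length \<gamma>) < ereal r"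
    using assms(1,3) unfolding length_space_def by (metis less_ereal.simps(1))
  then obtain \<gamma> where \<gamma>: "continuous_on {0..1} \<gamma>" "\<gamma> 0 = x" "\<gamma> 1 = y" "curve_length \<gamma> < ereal r"
    by (auto simp: INF_less_iff)
  with assms(2) obtain s where s: "s \<in> {0..1}" "\<gamma> s \<in> boundary c"
    using path_meets_boundary[of \<gamma> c] by auto
  have "ereal (dist x (\<gamma> s)) < ereal r"
    using dist_le_curve_length[OF s(1), of \<gamma>] \<gamma> by (metis order_le_less_trans)
  then show ?thesis using s(2) unfolding expansion_def by (auto simp: dist_commute)
qed

text \<open>If some past point were closer than \<open>r\<close>, so would be the nearest neighbor,
  which carries another label; this would put \<open>xs t\<close> within \<open>r\<close> of the
  boundary. For \<open>t = 0\<close>, a mistake by convention, there is no \<open>s < t\<close> and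
  the claim is vacuous.\<close>

lemma mistake_far_from_past:
  fixes xs :: "nat \<Rightarrow> 'a::metric_space"
  assumes "length_space TYPE('a)" and "valid_nn_rule nn" and "nn_mistake c nn xs t"
    and "s < t" and "xs t \<notin> expansion (boundary c) r"
  shows "r \<le> dist (xs t) (xs s)"
proof (rule ccontr)
  let ?h = "map xs [0..<t]" and ?n = "nn (map xs [0..<t]) (xs t)"
  assume "\<not> ?thesis"
  then have less: "dist (xs t) (xs s) < r" by simp
  have *: "?n < length ?h \<and> (\<forall>j < length ?h. dist (xs t) (?h ! ?n) \<le> dist (xs t) (?h ! j))"
    using assms(2,4) unfolding valid_nn_rule_def by (metis length_map length_upt list.size(3) diff_zero not_less_zero)
  then have "dist (xs t) (xs ?n) \<le> dist (xs t) (xs s)"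
    using assms(4) by (metis add_0 diff_zero length_map length_upt nth_map nth_upt)
  moreover have "c (xs t) \<noteq> c (xs ?n)"
    using assms(3,4) unfolding nn_mistake_def by auto
  ultimately show False
    using length_space_boundary_between[OF assms(1)] less assms(5) by (meson order_le_less_trans)
qed

section \<open>Covers from doubling and box dimension, and separated points\<close>

lemma covering_number_less_imp_cover:
  assumes "covering_number r A < ereal b"
  obtains S where "finite S" "A \<subseteq> (\<Union>x\<in>S. ball x r)" "real (card S) < b"
  using assms unfolding covering_number_def by (auto simp: INF_less_iff)

lemma cover_UN:
  assumes "finite S" and "A \<subseteq> (\<Union>x\<in>S. B x)"
    and "\<And>x. x \<in> S \<Longrightarrow> \<exists>T. finite T \<and> card T \<le> n \<and> B x \<subseteq> (\<Union>y\<in>T. C y)"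
  shows "\<exists>T. finite T \<and> card T \<le> card S * n \<and> A \<subseteq> (\<Union>y\<in>T. C y)"
proof -
  from assms(3) obtain F where F: "\<And>x. x \<in> S \<Longrightarrow> finite (F x) \<and> card (F x) \<le> n \<and> B x \<subseteq> (\<Union>y\<in>F x. C y)"
    by metis
  have "card (\<Union>x\<in>S. F x) \<le> (\<Sum>x\<in>S. card (F x))" using assms(1) by (rule card_UN_le)
  also have "\<dots> \<le> card S * n" using F sum_bounded_above[of S "\<lambda>x. card (F x)" n] by simp
  finally have "card (\<Union>x\<in>S. F x) \<le> card S * n" .
  moreover have "A \<subseteq> (\<Union>y\<in>(\<Union>x\<in>S. F x). C y)"
  proof
    fix a assume "a \<in> A"
    then obtain x where x: "x \<in> S" "a \<in> B x" using assms(2) by auto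
    with F[OF x(1)] obtain y where "y \<in> F x" "a \<in> C y" by auto
    with x(1) show "a \<in> (\<Union>y\<in>(\<Union>x\<in>S. F x). C y)" by auto
  qed
  moreover have "finite (\<Union>x\<in>S. F x)" using F assms(1) by simp
  ultimately show ?thesis by blast
qed

text \<open>Halving the radius \<open>n\<close> times multiplies the number of balls by at most
  \<open>D\<close> each time; \<open>D\<close> does not depend on the centre, the radius or
  \<open>n\<close>.\<close>

lemma doubling_imp_uniform_covers:
  assumes "finite_doubling_dimension TYPE('a::metric_space)"
  shows "\<exists>D. \<forall>n (x::'a) r. r > 0 \<longrightarrow>
    (\<exists>S. finite S \<and> card S \<le> D ^ n \<and> ball x r \<subseteq> (\<Union>y\<in>S. ball y (r / 2 ^ n)))"
proof -
  from assms obtain G C where C: "\<And>(x::'a) r. r > 0 \<Longrightarrow>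
      covering_number (r/2) (ball x r) \<le> ereal (C * 2 powr G)"
    unfolding finite_doubling_dimension_def by blast
  \<comment> \<open>The summand \<open>1\<close> makes the bound on the covering number strict, as
    extracting an actual cover requires.\<close>
  define D where "D = nat \<lceil>C * 2 powr G + 1\<rceil>"
  have one: "\<exists>S. finite S \<and> card S \<le> D \<and> ball x r \<subseteq> (\<Union>y\<in>S. ball y (r / 2))" if "r > 0" for x :: 'a and r
  proof -
    have "covering_number (r/2) (ball x r) < ereal (C * 2 powr G + 1)"
      using C[OF that, of x] by (rule order_le_less_trans) simp
    then obtain S where S: "finite S" "ball x r \<subseteq> (\<Union>x\<in>S. ball x (r/2))" "real (card S) < C * 2 powr G + 1"
      by (rule covering_number_less_imp_cover)
    then have "card S \<le> D" unfolding D_def by linarith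
    with S show ?thesis by blast
  qed
  have "\<exists>S. finite S \<and> card S \<le> D ^ n \<and> ball x r \<subseteq> (\<Union>y\<in>S. ball y (r / 2 ^ n))"
    if "r > 0" for n and x :: 'a and r
  proof (induction n)
    case 0
    show ?case by (intro exI[of _ "{x}"]) simp
  next
    case (Suc n)
    then obtain S where S: "finite S" "card S \<le> D ^ n" "ball x r \<subseteq> (\<Union>y\<in>S. ball y (r / 2 ^ n))" by blast
    have "\<exists>T. finite T \<and> card T \<le> card S * D \<and> ball x r \<subseteq> (\<Union>y\<in>T. ball y (r / 2 ^ n / 2))"
      by (rule cover_UN[OF S(1,3)]) (rule one, use that in simp)
    moreover have "card S * D \<le> D ^ Suc n" using S(2) by (simp add: mult.commute)
    ultimately show ?case by (metis divide_divide_eq_left power_Suc2 order_trans)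
  qed
  then show ?thesis by blast
qed

text \<open>A ball of radius \<open>s / 2\<close> contains at most one of the points, so choosing a
  centre for each index is injective. Indices rather than points are counted, and finiteness of
  \<open>I\<close> is part of the conclusion.\<close>

lemma separated_card_le_cover:
  fixes x :: "nat \<Rightarrow> 'a::metric_space"
  assumes "finite S" and "x ` I \<subseteq> (\<Union>z\<in>S. ball z (s / 2))"
    and "\<And>i j. i \<in> I \<Longrightarrow> j \<in> I \<Longrightarrow> i < j \<Longrightarrow> s \<le> dist (x j) (x i)"
  shows "finite I \<and> card I \<le> card S"
proof -
  have "\<forall>i\<in>I. \<exists>z\<in>S. dist z (x i) < s / 2"
  proof
    fix i assume "i \<in> I"
    then have "x i \<in> (\<Union>z\<in>S. ball z (s / 2))" using assms(2) by blast
    then show "\<exists>z\<in>S. dist z (x i) < s / 2" by (simp only: UN_iff mem_ball)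
  qed
  then obtain f where f: "\<And>i. i \<in> I \<Longrightarrow> f i \<in> S \<and> dist (f i) (x i) < s / 2" by metis
  have "f i \<noteq> f j" if "i \<in> I" "j \<in> I" "i < j" for i j
    using f[OF that(1)] f[OF that(2)] assms(3)[OF that] dist_triangle_half_r[of "f i" "x j" s "x i"]
    by auto
  then have "inj_on f I" by (intro linorder_inj_onI) auto
  moreover have "f ` I \<subseteq> S" using f by auto
  ultimately show ?thesis
    using assms(1) by (metis inj_on_finite card_inj_on_le)
qed

text \<open>An exponent \<open>q\<close> above the upper box dimension gives at most
  \<open>r powr - q\<close> balls for all small \<open>r\<close>; here \<open>r\<close> is a power
  of \<open>1/2\<close>. The leading factor 2 absorbs the \<open>1\<close> lost when a cover is
  extracted.\<close>

lemma box_dim_imp_dyadic_covers: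
  fixes A :: "'a::metric_space set"
  assumes "box_dim A = ereal d" and "d < q" and "0 < q"
  shows "\<exists>k0. \<forall>k\<ge>k0. \<exists>S. finite S \<and> A \<subseteq> (\<Union>x\<in>S. ball x ((1/2)^k)) \<and> real (card S) \<le> 2 * 2 powr (real k * q)"
proof -
  let ?f = "\<lambda>r. if covering_number r A = \<infinity> then \<infinity>
          else ereal (ln (real_of_ereal (covering_number r A)) / ln (1 / r))"
  have "Limsup (at_right (0::real)) ?f < ereal q"
    using assms unfolding box_dim_def by simp
  then have "eventually (\<lambda>r. ?f r < ereal q) (at_right 0)"
    by (rule Limsup_lessD)
  then obtain b where b: "b > 0" "\<And>r. 0 < r \<Longrightarrow> r < b \<Longrightarrow> ?f r < ereal q"
    unfolding eventually_at_right_field by blast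
  obtain k0 where k0: "(1/2::real) ^ k0 < b" using real_arch_pow_inv[of b "1/2"] b(1) by auto
  \<comment> \<open>Starting at \<open>Suc k0\<close> excludes \<open>k = 0\<close>, where the
    denominator \<open>ln (1 / r)\<close> would vanish.\<close>
  have "\<exists>S. finite S \<and> A \<subseteq> (\<Union>x\<in>S. ball x ((1/2)^k)) \<and> real (card S) \<le> 2 * 2 powr (real k * q)"
    if "Suc k0 \<le> k" for k
  proof -
    let ?r = "(1/2::real)^k"
    have "?r \<le> (1/2)^k0" using that by (intro power_decreasing) auto
    then have "?r < b" using k0 by (rule order_le_less_trans)
    then have f: "?f ?r < ereal q" by (intro b(2)) auto
    have "covering_number ?r A \<ge> 0" unfolding covering_number_def by (intro INF_greatest) auto
    moreover have "covering_number ?r A \<noteq> \<infinity>" using f by auto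
    ultimately obtain N where N: "covering_number ?r A = ereal N" "N \<ge> 0"
      by (cases "covering_number ?r A") auto
    have "ln N / ln (1 / ?r) < q" using f unfolding N(1) by simp
    moreover have ln: "ln (1 / ?r) = real k * ln 2" by (simp add: power_one_over ln_realpow)
    moreover have "real k * ln 2 > 0" using that by simp
    ultimately have "ln N < q * (real k * ln 2)" by (simp add: pos_divide_less_eq)
    then have le: "N \<le> 2 powr (real k * q)"
    proof (cases "N = 0")
      case False
      with N(2) have "N = exp (ln N)" by simp
      also have "\<dots> \<le> exp (q * (real k * ln 2))" using \<open>ln N < _\<close> by simp
      finally show ?thesis by (simp add: powr_def mult_ac)
    qed auto
    have "1 \<le> 2 powr (real k * q)" using assms(3) by (intro ge_one_powr_ge_zero) auto
    have "covering_number ?r A < ereal (N + 1)" using N by simp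
    then obtain S where "finite S" "A \<subseteq> (\<Union>x\<in>S. ball x ?r)" "real (card S) < N + 1"
      by (rule covering_number_less_imp_cover)
    with le \<open>1 \<le> _\<close> show ?thesis by (intro exI[of _ S]) auto
  qed
  then show ?thesis by blast
qed

section \<open>Deterministic count of the mistakes away from the boundary\<close>

lemma expansion_mono: "r \<le> s \<Longrightarrow> expansion A r \<subseteq> expansion A s"
  unfolding expansion_def by fastforce

lemma open_expansion: "open (expansion A r)"
  unfolding expansion_def by auto

text \<open>Mistakes outside the neighbourhood are separated, hence bounded by covers: of the whole
  space at a coarse scale, of the neighbourhoods of the boundary at each finer one. \<open>B\<close>
  is chosen before \<open>nn\<close>, \<open>xs\<close> and \<open>K\<close>, so the bound holds on
  every sample path, over all rounds at once.\<close>

lemma mistakes_outside_expansion: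
  assumes "length_space TYPE('a::metric_space)" and "bounded (UNIV :: 'a set)"
    and "finite_doubling_dimension TYPE('a)"
    and "box_dim (boundary (c :: 'a \<Rightarrow> 'b)) = ereal d" and "d < q" and "1 \<le> q"
  shows "\<exists>B\<ge>0. \<forall>nn xs K. valid_nn_rule nn \<longrightarrow>
    finite {t. nn_mistake c nn xs t \<and> xs t \<notin> expansion (boundary c) ((1/2)^K)} \<and>
    real (card {t. nn_mistake c nn xs t \<and> xs t \<notin> expansion (boundary c) ((1/2)^K)}) \<le> B * 2 powr (real K * q)"
proof -
  from doubling_imp_uniform_covers[OF assms(3)] obtain D where D: "\<And>n (x::'a) r. r > 0 \<Longrightarrow>
    \<exists>S. finite S \<and> card S \<le> D ^ n \<and> ball x r \<subseteq> (\<Union>y\<in>S. ball y (r / 2 ^ n))" by blast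
  from box_dim_imp_dyadic_covers[OF assms(4,5)] assms(6) obtain k0 where k0: "\<And>k. k \<ge> k0 \<Longrightarrow>
    \<exists>S. finite S \<and> boundary c \<subseteq> (\<Union>x\<in>S. ball x ((1/2)^k)) \<and> real (card S) \<le> 2 * 2 powr (real k * q)" by force
  obtain x0 R where R: "R > 0" "UNIV \<subseteq> ball (x0::'a) R"
    using assms(2) by (metis bounded_subset_ballD)
  \<comment> \<open>After \<open>n0\<close> halvings, balls covering the whole space have radius at
    most half the separation at scale \<open>k0\<close>.\<close>
  obtain n0 where n0: "(1/2::real) ^ n0 < (1/2)^k0 / 2 / R"
    using real_arch_pow_inv[of "(1/2)^k0 / 2 / R" "1/2"] R(1) by auto
  let ?V = "\<lambda>k. expansion (boundary c) ((1/2)^k)"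
  define L where "L nn xs k = {t. nn_mistake c nn xs t \<and> xs t \<notin> ?V k}" for nn xs k
  have sep: "(1/2)^k \<le> dist (xs j) (xs i)"
    if "valid_nn_rule nn" "j \<in> L nn xs k" "i < j" for nn xs i j k
    using mistake_far_from_past[OF assms(1) that(1) _ that(3)] that(2) unfolding L_def by blast
  define B0 where "B0 = real (D ^ n0)"
  \<comment> \<open>The 2 comes from the dyadic covers of the boundary. The cube is three halvings,
    from radius \<open>2 * (1/2)^k\<close>, which covers the neighbourhood, to half the separation
    \<open>(1/2)^Suc k\<close>.\<close>
  define F where "F = 2 * real D ^ 3"
  have coarse: "finite (L nn xs k0) \<and> real (card (L nn xs k0)) \<le> B0" if nn: "valid_nn_rule nn" for nn xs
  proof -
    obtain S where S: "finite S" "card S \<le> D ^ n0" "ball x0 R \<subseteq> (\<Union>y\<in>S. ball y (R / 2 ^ n0))"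
      using D[OF R(1)] by blast
    have "R / 2 ^ n0 \<le> (1/2)^k0 / 2" using n0 R(1) by (simp add: field_simps)
    then have "ball y (R / 2 ^ n0) \<subseteq> ball y ((1/2)^k0 / 2)" for y :: 'a by (rule subset_ball)
    with S(3) R(2) have "xs ` L nn xs k0 \<subseteq> (\<Union>y\<in>S. ball y ((1/2)^k0 / 2))" by blast
    then have "finite (L nn xs k0) \<and> card (L nn xs k0) \<le> card S"
      by (rule separated_card_le_cover[OF S(1)]) (rule sep[OF nn])
    with S(2) show ?thesis unfolding B0_def by (metis of_nat_le_iff order_trans)
  qed
  have annulus: "finite (L nn xs (Suc k) - L nn xs k) \<and>
      real (card (L nn xs (Suc k) - L nn xs k)) \<le> F * 2 powr (real k * q)"
    if nn: "valid_nn_rule nn" and k: "k \<ge> k0" for nn xs k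
  proof -
    obtain S where S: "finite S" "boundary c \<subseteq> (\<Union>x\<in>S. ball x ((1/2)^k))"
      "real (card S) \<le> 2 * 2 powr (real k * q)" using k0[OF k] by blast
    have "?V k \<subseteq> (\<Union>x\<in>S. ball x (2 * (1/2)^k))"
    proof
      fix z assume "z \<in> ?V k"
      then obtain b where b: "b \<in> boundary c" "dist b z < (1/2)^k" unfolding expansion_def by auto
      then obtain x where "x \<in> S" "dist x b < (1/2)^k" using S(2) by auto
      then have "dist x z < 2 * (1/2)^k" using b(2) dist_triangle[of x z b] by linarith
      with \<open>x \<in> S\<close> show "z \<in> (\<Union>x\<in>S. ball x (2 * (1/2)^k))" by auto
    qed
    then have "\<exists>T. finite T \<and> card T \<le> card S * D ^ 3 \<and>
        ?V k \<subseteq> (\<Union>y\<in>T. ball y (2 * (1/2)^k / 2 ^ 3))"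
      by (rule cover_UN[OF S(1)]) (rule D, simp)
    then obtain T where T: "finite T" "card T \<le> card S * D ^ 3"
      "?V k \<subseteq> (\<Union>y\<in>T. ball y (2 * (1/2)^k / 2 ^ 3))" by blast
    have "finite (L nn xs (Suc k) - L nn xs k) \<and> card (L nn xs (Suc k) - L nn xs k) \<le> card T"
    proof (rule separated_card_le_cover[OF T(1)])
      have "(2 * (1/2)^k / 2 ^ 3 :: real) = (1/2) ^ Suc k / 2" by simp
      with T(3) have "?V k \<subseteq> (\<Union>z\<in>T. ball z ((1/2) ^ Suc k / 2))" by (simp only:)
      moreover have "xs ` (L nn xs (Suc k) - L nn xs k) \<subseteq> ?V k" unfolding L_def by blast
      ultimately show "xs ` (L nn xs (Suc k) - L nn xs k) \<subseteq> (\<Union>z\<in>T. ball z ((1/2) ^ Suc k / 2))"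
        by blast
    qed (use sep[OF nn] in blast)
    moreover have "real (card T) \<le> real (card S) * real D ^ 3" using T(2)
      by (metis of_nat_le_iff of_nat_mult of_nat_power)
    moreover have "\<dots> \<le> 2 * 2 powr (real k * q) * real D ^ 3" using S(3) by (intro mult_right_mono) auto
    ultimately show ?thesis unfolding F_def by (simp add: mult_ac)
  qed
  \<comment> \<open>The geometric sum is kept in closed form: since \<open>1 \<le> q\<close>, one
    scale step multiplies the bound by \<open>2 powr q \<ge> 2\<close>, which leaves room for the
    new annulus without changing \<open>F\<close>.\<close>
  have main: "finite (L nn xs K) \<and> real (card (L nn xs K)) \<le> B0 + F * 2 powr (real K * q)"
    if nn: "valid_nn_rule nn" and "K \<ge> k0" for nn xs K
    using that(2)
  proof (induction K rule: dec_induct)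
    case base
    have "F * 2 powr (real k0 * q) \<ge> 0" unfolding F_def by simp
    with coarse[OF nn, of xs] show ?case by linarith
  next
    case (step k)
    let ?A = "L nn xs (Suc k) - L nn xs k"
    note a = annulus[OF nn step(1), of xs]
    have sub: "L nn xs (Suc k) \<subseteq> L nn xs k \<union> ?A" by blast
    have fin: "finite (L nn xs k \<union> ?A)" using step a by blast
    have "card (L nn xs (Suc k)) \<le> card (L nn xs k \<union> ?A)" by (rule card_mono[OF fin sub])
    also have "\<dots> \<le> card (L nn xs k) + card ?A" by (rule card_Un_le)
    finally have "real (card (L nn xs (Suc k))) \<le> real (card (L nn xs k)) + real (card ?A)" by linarith
    also have "\<dots> \<le> B0 + F * 2 powr (real k * q) + F * 2 powr (real k * q)" using step a by linarith
    also have "\<dots> = B0 + F * 2 powr (real k * q) * 2" by simp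
    also have "\<dots> \<le> B0 + F * 2 powr (real k * q) * 2 powr q"
    proof -
      have "2 powr 1 \<le> 2 powr q" using assms(6) by (intro powr_mono) auto
      then show ?thesis unfolding F_def by (intro add_left_mono mult_left_mono) auto
    qed
    also have "\<dots> = B0 + F * 2 powr (real (Suc k) * q)" by (simp add: powr_add algebra_simps)
    finally show ?case using finite_subset[OF sub fin] by blast
  qed
  show ?thesis
  proof (intro exI[of _ "B0 + F"] conjI allI impI)
    show "0 \<le> B0 + F" unfolding B0_def F_def by simp
    fix nn xs K assume nn: "valid_nn_rule (nn :: 'a list \<Rightarrow> 'a \<Rightarrow> nat)"
    have "finite (L nn xs K) \<and> real (card (L nn xs K)) \<le> B0 + F * 2 powr (real K * q)"
    \<comment> \<open>At scales coarser than \<open>k0\<close> the excluded neighbourhood is larger,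
      so the count at \<open>k0\<close> dominates.\<close>
    proof (cases "K \<ge> k0")
      case False
      then have "(1/2::real)^k0 \<le> (1/2)^K" by (intro power_decreasing) auto
      then have "L nn xs K \<subseteq> L nn xs k0" unfolding L_def using expansion_mono[of "(1/2)^k0" "(1/2)^K" "boundary c"] by blast
      with coarse[OF nn, of xs] have "finite (L nn xs K)" "real (card (L nn xs K)) \<le> B0"
        by (auto intro: finite_subset order_trans[OF of_nat_mono[OF card_mono]])
      moreover have "F * 2 powr (real K * q) \<ge> 0" unfolding F_def by simp
      ultimately show ?thesis by linarith
    qed (rule main[OF nn])
    moreover have "B0 * 1 \<le> B0 * 2 powr (real K * q)" unfolding B0_def using assms(6)
      by (intro mult_left_mono ge_one_powr_ge_zero) auto
    ultimately show "finite {t. nn_mistake c nn xs t \<and> xs t \<notin> ?V K}"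
      "real (card {t. nn_mistake c nn xs t \<and> xs t \<notin> ?V K}) \<le> (B0 + F) * 2 powr (real K * q)"
      unfolding L_def by (auto simp: algebra_simps)
  qed
qed

section \<open>Probability and number of visits near the boundary\<close>

lemma minkowski_content_imp_dyadic_bound:
  assumes "finite_measure \<nu>" and "measure \<nu> A = 0" and "minkowski_content \<nu> A = ereal m"
  shows "\<exists>G>0. \<forall>K. measure \<nu> (expansion A ((1/2)^K)) \<le> G * (1/2)^K"
proof -
  interpret finite_measure \<nu> by fact
  have "Limsup (at_right (0::real)) (\<lambda>r. ereal ((measure \<nu> (expansion A r) - measure \<nu> A) / r)) < ereal (m + 1)"
    using assms(3) unfolding minkowski_content_def by simp
  then have "eventually (\<lambda>r. ereal ((measure \<nu> (expansion A r) - measure \<nu> A) / r) < ereal (m + 1)) (at_right 0)"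
    by (rule Limsup_lessD)
  then obtain b where b: "b > 0" "\<And>r. 0 < r \<Longrightarrow> r < b \<Longrightarrow> measure \<nu> (expansion A r) / r < m + 1"
    using assms(2) unfolding eventually_at_right_field by auto
  \<comment> \<open>The first summand serves radii below \<open>b\<close>, where the limsup is
    effective; the second serves radii from \<open>b\<close> on, through the total mass; the last
    makes \<open>G\<close> positive.\<close>
  define G where "G = \<bar>m + 1\<bar> + measure \<nu> (space \<nu>) / b + 1"
  have "measure \<nu> (expansion A r) \<le> G * r" if "r > 0" for r
  proof (cases "r < b")
    case True
    then have "measure \<nu> (expansion A r) \<le> (m + 1) * r" using b(2)[OF that] that by (simp add: field_simps)
    also have "\<dots> \<le> G * r" unfolding G_def using that b(1) by (intro mult_right_mono) (auto simp: add_increasing2)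
    finally show ?thesis .
  next
    case False
    have "measure \<nu> (expansion A r) \<le> measure \<nu> (space \<nu>) / b * b" using b(1) by (simp add: bounded_measure)
    also have "\<dots> \<le> G * r" unfolding G_def using False b(1) by (intro mult_mono) auto
    finally show ?thesis .
  qed
  moreover have "G > 0" unfolding G_def using b(1) by (simp add: add_nonneg_pos)
  ultimately show ?thesis by (intro exI[of _ G]) simp
qed

text \<open>Gives \<open>m + c2 > 0\<close> in the theorem, so the base of its power is positive for
  \<open>T > 0\<close>.\<close>

lemma minkowski_content_nonneg:
  assumes "measure \<nu> A = 0"
  shows "0 \<le> minkowski_content \<nu> A"
  unfolding minkowski_content_def
proof (rule le_Limsup)
  show "\<forall>\<^sub>F r in at_right 0. 0 \<le> ereal ((measure \<nu> (expansion A r) - measure \<nu> A) / r)"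
    using eventually_at_right_less[of "0::real"] by eventually_elim (simp add: assms)
qed simp

text \<open>Smoothness bounds the conditional probability after every history by the same constant;
  taking \<open>F = space M\<close> in the protocol averages over histories.\<close>

lemma smooth_process_hit_prob:
  assumes "smooth_adversary \<nu> \<sigma> \<mu>" and "adaptive_process M \<mu> X" and "A \<in> sets borel"
    and "\<sigma> > 0"
  shows "measure M (X t -` A \<inter> space M) \<le> measure \<nu> A / \<sigma>"
proof -
  interpret prob_space M using assms(2) unfolding adaptive_process_def by blast
  have "emeasure M (space M \<inter> (X t -` A \<inter> space M)) =
      (\<integral>\<^sup>+ \<omega>. indicator (space M) \<omega> * emeasure (\<mu> (history X t \<omega>)) A \<partial>M)"
    using assms(2,3) sigma_sets_top unfolding adaptive_process_def by blast
  also have "\<dots> \<le> (\<integral>\<^sup>+ \<omega>. ennreal (measure \<nu> A / \<sigma>) \<partial>M)"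
  proof (rule nn_integral_mono)
    fix \<omega> assume "\<omega> \<in> space M"
    let ?P = "\<mu> (history X t \<omega>)"
    interpret P: prob_space ?P using assms(1) unfolding smooth_adversary_def by blast
    have "measure ?P A \<le> measure \<nu> A / \<sigma>" using assms(1,3) unfolding smooth_adversary_def by blast
    with \<open>\<omega> \<in> space M\<close> show "indicator (space M) \<omega> * emeasure ?P A \<le> ennreal (measure \<nu> A / \<sigma>)"
      by (simp add: P.emeasure_eq_measure ennreal_leI)
  qed
  also have "\<dots> = ennreal (measure \<nu> A / \<sigma>)" by (simp add: emeasure_space_1)
  finally show ?thesis using assms(4) by (simp add: emeasure_eq_measure ennreal_le_iff inf.absorb2)
qed

text \<open>Markov's inequality together with a union bound over all \<open>K\<close>; the slack \<open>\<epsilon>\<close> in the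
  exponent is what makes the failure probabilities summable.\<close>
lemma hits_bounded_with_high_prob:
  assumes "prob_space M" and "\<And>t. X t \<in> measurable M borel" and "\<And>K. V K \<in> sets borel"
    and "\<And>t K. measure M (X t -` V K \<inter> space M) \<le> G * (1/2)^K" and "G > 0"
    and "0 \<le> d" and "0 < \<epsilon>" and "p > 0"
  shows "\<exists>A>0. \<exists>E\<in>sets M. measure M E \<ge> 1 - p \<and>
    (\<forall>\<omega>\<in>E. \<forall>K. real (card {t::nat. real t < 2 powr (real K * (d + 1)) \<and> X t \<omega> \<in> V K})
        \<le> A * 2 powr (real K * (d + \<epsilon>)))"
proof -
  interpret prob_space M by fact
  define I where "I K = {t::nat. real t < 2 powr (real K * (d + 1))}" for K
  define S where "S K \<omega> = (\<Sum>t\<in>I K. indicator (X t -` V K \<inter> space M) \<omega> :: real)" for K \<omega>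
  define \<rho> where "\<rho> = (2 powr - \<epsilon> :: real)"
  have \<rho>: "0 < \<rho>" "\<rho> < 1" using assms(7) powr_less_mono[of "-\<epsilon>" 0 2] unfolding \<rho>_def by auto
  \<comment> \<open>Chosen so that Markov's inequality bounds the failure probability at scale
    \<open>K\<close> by \<open>p * (1 - \<rho>) * \<rho> ^ K\<close>, which sums to
    \<open>p\<close>.\<close>
  define A where "A = 2 * G / (p * (1 - \<rho>))"
  have A: "A > 0" unfolding A_def using \<rho> assms(5,8) by simp
  have I_eq: "I K = {..<nat \<lceil>2 powr (real K * (d + 1))\<rceil>}" for K unfolding I_def by (auto; linarith)
  have finI: "finite (I K)" for K unfolding I_eq by simp
  have cardI: "real (card (I K)) \<le> 2 * 2 powr (real K * (d + 1))" for K
  proof -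
    have "1 \<le> 2 powr (real K * (d + 1))" using assms(6) by (intro ge_one_powr_ge_zero) auto
    then show ?thesis unfolding I_eq by simp linarith
  qed
  have ev[measurable]: "X t -` V K \<inter> space M \<in> events" for t K using assms(2,3) by (rule measurable_sets)
  have S_int: "integrable M (S K)" for K
    unfolding S_def by (intro Bochner_Integration.integrable_sum integrable_real_indicator)
      (auto simp: emeasure_eq_measure)
  have S_meas[measurable]: "S K \<in> borel_measurable M" for K using S_int by auto
  \<comment> \<open>Up to constants, \<open>2 powr (K * (d + 1))\<close> rounds each hit with
    probability \<open>2 powr - K\<close>.\<close>
  have S_exp: "integral\<^sup>L M (S K) \<le> 2 * G * 2 powr (real K * d)" for K
  proof -
    have "integral\<^sup>L M (S K) = (\<Sum>t\<in>I K. measure M (X t -` V K \<inter> space M))"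
      unfolding S_def by (subst Bochner_Integration.integral_sum) (auto simp: emeasure_eq_measure inf.absorb1)
    also have "\<dots> \<le> real (card (I K)) * (G * (1/2)^K)" by (intro sum_bounded_above assms(4))
    also have "\<dots> \<le> 2 * 2 powr (real K * (d + 1)) * (G * (1/2)^K)"
      using cardI assms(5) by (intro mult_right_mono) auto
    also have "(1/2::real)^K = 2 powr (- real K)" by (simp add: powr_minus powr_realpow power_one_over inverse_eq_divide)
    also have "2 * 2 powr (real K * (d + 1)) * (G * 2 powr (- real K)) = 2 * G * 2 powr (real K * d)"
      by (simp add: powr_add[symmetric] algebra_simps)
    finally show ?thesis .
  qed
  define bad where "bad K = {\<omega>\<in>space M. A * 2 powr (real K * (d + \<epsilon>)) \<le> S K \<omega>}" for K
  have bad_ev[measurable]: "bad K \<in> events" for K unfolding bad_def by measurable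
  have bad_prob: "prob (bad K) \<le> p * (1 - \<rho>) * \<rho> ^ K" for K
  proof -
    have "prob (bad K) \<le> integral\<^sup>L M (S K) / (A * 2 powr (real K * (d + \<epsilon>)))"
      unfolding bad_def using A
      by (intro integral_Markov_inequality_measure[OF S_int, of "space M"]) (auto simp: S_def sum_nonneg)
    also have "\<dots> \<le> (2 * G * 2 powr (real K * d)) / (A * 2 powr (real K * (d + \<epsilon>)))"
      using A S_exp by (intro divide_right_mono) auto
    also have "\<dots> = 2 * G / A * 2 powr (real K * d - real K * (d + \<epsilon>))"
      by (simp add: powr_diff)
    also have "2 * G / A = p * (1 - \<rho>)" unfolding A_def using \<rho> assms(5,8) by simp
    also have "real K * d - real K * (d + \<epsilon>) = - \<epsilon> * real K" by (simp add: algebra_simps)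
    also have "2 powr (- \<epsilon> * real K) = \<rho> ^ K" unfolding \<rho>_def
      by (subst powr_powr[symmetric], subst powr_realpow) auto
    finally show ?thesis .
  qed
  have sums: "(\<lambda>K. p * (1 - \<rho>) * \<rho> ^ K) sums (p * (1 - \<rho>) * (1 / (1 - \<rho>)))"
    using \<rho> by (intro sums_mult geometric_sums) auto
  have summ: "summable (\<lambda>K. prob (bad K))"
    by (rule summable_comparison_test'[OF sums_summable[OF sums], of 0]) (simp add: bad_prob)
  have "prob (\<Union>K. bad K) \<le> (\<Sum>K. prob (bad K))"
    by (rule finite_measure_subadditive_countably) (use summ in auto)
  also have "\<dots> \<le> (\<Sum>K. p * (1 - \<rho>) * \<rho> ^ K)"
    by (rule suminf_le[OF bad_prob summ sums_summable[OF sums]])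
  also have "\<dots> = p" using sums_unique[OF sums] \<rho> by simp
  finally have le: "prob (\<Union>K. bad K) \<le> p" .
  define E where "E = space M - (\<Union>K. bad K)"
  have "E \<in> events" unfolding E_def by measurable
  moreover have "prob E \<ge> 1 - p" unfolding E_def using le by (subst prob_compl) auto
  moreover have "real (card {t::nat. real t < 2 powr (real K * (d + 1)) \<and> X t \<omega> \<in> V K})
        \<le> A * 2 powr (real K * (d + \<epsilon>))" if "\<omega> \<in> E" for \<omega> K
  proof -
    have "\<omega> \<in> space M" "\<omega> \<notin> bad K" using that unfolding E_def by auto
    then have "S K \<omega> < A * 2 powr (real K * (d + \<epsilon>))" unfolding bad_def by auto
    moreover have "S K \<omega> = (\<Sum>t\<in>I K. if X t \<omega> \<in> V K then 1 else 0)"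
      unfolding S_def using \<open>\<omega> \<in> space M\<close> by (intro sum.cong) (auto simp: indicator_def)
    then have "S K \<omega> = real (card (I K \<inter> {t. X t \<omega> \<in> V K}))"
      using finI[of K] by (simp add: sum.If_cases)
    moreover have "I K \<inter> {t. X t \<omega> \<in> V K} = {t. real t < 2 powr (real K * (d + 1)) \<and> X t \<omega> \<in> V K}"
      unfolding I_def by auto
    ultimately show ?thesis by simp
  qed
  ultimately show ?thesis using A by blast
qed

section \<open>Choice of the scale and the final bound\<close>

text \<open>The least \<open>K\<close> satisfying the first inequality works: it is positive because
  \<open>1 \<le> T\<close>, and the failure of the inequality at its predecessor gives the
  second.\<close>

lemma dyadic_scale_exists:
  assumes "1 \<le> (T::real)" and "a > 0"
  shows "\<exists>K. T < 2 powr (real K * a) \<and> 2 powr (real K * a) \<le> 2 powr a * T"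
proof -
  let ?P = "\<lambda>K. T < 2 powr (real K * a)"
  obtain n where n: "T < (2 powr a) ^ n"
    using real_arch_pow[of "2 powr a" T] assms(2) by (auto simp: less_powr_iff)
  have "(2 powr a) ^ n = 2 powr (real n * a)"
    by (simp add: powr_realpow[symmetric] powr_powr mult.commute)
  with n have ex: "?P n" by simp
  define K where "K = (LEAST K. ?P K)"
  have K: "?P K" unfolding K_def by (rule LeastI[of ?P, OF ex])
  have "K \<noteq> 0" using K assms(1) by (intro notI) simp
  then obtain k where k: "K = Suc k" by (cases K) auto
  have "\<not> ?P k" using not_less_Least[of k ?P] k unfolding K_def by auto
  then have "2 powr a * 2 powr (real k * a) \<le> 2 powr a * T" by (intro mult_left_mono) auto
  then have "2 powr (real K * a) \<le> 2 powr a * T" unfolding k by (simp add: powr_add[symmetric] algebra_simps)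
  with K show ?thesis by blast
qed

theorem theorem9:
  fixes \<nu> :: "'a::metric_space measure"
    and c :: "'a \<Rightarrow> 'b"
    and \<sigma> d m c1 c2 p :: real
    and \<mu> :: "'a list \<Rightarrow> 'a measure"
    and M :: "'w measure"
    and X :: "nat \<Rightarrow> 'w \<Rightarrow> 'a"
  assumes "length_space TYPE('a)"
    and "bounded (UNIV :: 'a set)"
    and "finite_doubling_dimension TYPE('a)"
    and "sets \<nu> = sets borel" and "finite_measure \<nu>"
    and "boundary c \<in> null_sets \<nu>"
    and "\<sigma> > 0" and "smooth_adversary \<nu> \<sigma> \<mu>"
    and "adaptive_process M \<mu> X"
    and "box_dim (boundary c) = ereal d" and "d > 1"
    and "minkowski_content \<nu> (boundary c) = ereal m"
    and "c1 > 0" and "c2 > 0" and "p > 0"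
  shows "\<exists>C0 C1. C0 > 0 \<and> C1 > 0 \<and>
    (\<exists>E \<in> prob_space.events M. prob_space.prob M E \<ge> 1 - p \<and>
       (\<forall>\<omega> \<in> E. \<forall>nn. valid_nn_rule nn \<longrightarrow> (\<forall>T::nat.
          real (num_mistakes c nn (\<lambda>t. X t \<omega>) T)
            \<le> C0 + C1 * (((m + c2) * real T / \<sigma>) powr ((d + c1) / (d + 1))))))"
proof -
  let ?V = "\<lambda>K. expansion (boundary c) ((1/2)^K)" and ?q = "d + c1" and ?e = "(d + c1) / (d + 1)"
  have null: "measure \<nu> (boundary c) = 0" using assms(6) by (rule measure_eq_0_null_sets)
  have "m \<ge> 0" using minkowski_content_nonneg[OF null] assms(12) by simp
  obtain G where G: "G > 0" "\<And>K. measure \<nu> (?V K) \<le> G * (1/2)^K"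
    using minkowski_content_imp_dyadic_bound[OF assms(5) null assms(12)] by blast
  obtain B where B: "B \<ge> 0" "\<And>nn xs K. valid_nn_rule nn \<Longrightarrow>
      finite {t. nn_mistake c nn xs t \<and> xs t \<notin> ?V K} \<and>
      real (card {t. nn_mistake c nn xs t \<and> xs t \<notin> ?V K}) \<le> B * 2 powr (real K * ?q)"
    using mistakes_outside_expansion[OF assms(1-3,10), of ?q] assms(11,13) by auto
  have M: "prob_space M" and X: "\<And>t. X t \<in> measurable M borel"
    using assms(9) unfolding adaptive_process_def by blast+
  have V: "?V K \<in> sets borel" for K by (simp add: open_expansion)
  have hit: "measure M (X t -` ?V K \<inter> space M) \<le> G / \<sigma> * (1/2)^K" for t K
  proof -
    have "measure M (X t -` ?V K \<inter> space M) \<le> measure \<nu> (?V K) / \<sigma>"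
      by (rule smooth_process_hit_prob[OF assms(8,9) V assms(7)])
    also have "\<dots> \<le> G * (1/2)^K / \<sigma>" using assms(7) G(2) by (intro divide_right_mono) auto
    finally show ?thesis by simp
  qed
  \<comment> \<open>With slack \<open>c1\<close>, the hits get the same exponent \<open>?q\<close>
    as the far mistakes. \<open>E\<close> is fixed before \<open>nn\<close> and
    \<open>T\<close>.\<close>
  obtain A E where A: "A > 0" and E: "E \<in> sets M" "measure M E \<ge> 1 - p"
    and hits: "\<And>\<omega> K. \<omega> \<in> E \<Longrightarrow>
      real (card {t::nat. real t < 2 powr (real K * (d + 1)) \<and> X t \<omega> \<in> ?V K}) \<le> A * 2 powr (real K * ?q)"
    using hits_bounded_with_high_prob[where X = X and V = ?V and G = "G / \<sigma>" and d = d and \<epsilon> = c1 and p = p,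
        OF M X V hit] G(1) assms(7,11,13,15) by auto
  define b where "b = (m + c2) / \<sigma>"
  have b: "b > 0" unfolding b_def using \<open>m \<ge> 0\<close> assms(7,14) by simp
  \<comment> \<open>\<open>b powr - ?e\<close> cancels the power of \<open>b\<close> in the target;
    \<open>2 powr ?q\<close> is \<open>(2 powr (d + 1)) powr ?e\<close>, the cost of rounding
    \<open>T\<close> up to a dyadic horizon.\<close>
  define C1 where "C1 = (A + B) * 2 powr ?q * b powr - ?e"
  have "C1 > 0" unfolding C1_def using A B(1) b by simp
  moreover have "real (num_mistakes c nn (\<lambda>t. X t \<omega>) T)
      \<le> 1 + C1 * (((m + c2) * real T / \<sigma>) powr ?e)"
    if \<omega>: "\<omega> \<in> E" and nn: "valid_nn_rule nn" for \<omega> nn T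
  proof (cases "T = 0")
    case True
    then show ?thesis by (simp add: num_mistakes_def)
  next
    case False
    then obtain K where K: "real T < 2 powr (real K * (d + 1))"
      "2 powr (real K * (d + 1)) \<le> 2 powr (d + 1) * real T"
      using dyadic_scale_exists[of "real T" "d + 1"] assms(11) by auto
    let ?xs = "\<lambda>t. X t \<omega>"
    let ?N = "{t. real t < 2 powr (real K * (d + 1)) \<and> X t \<omega> \<in> ?V K}"
      and ?F = "{t. nn_mistake c nn ?xs t \<and> ?xs t \<notin> ?V K}"
    \<comment> \<open>A mistake before \<open>T\<close> either lies near the boundary, and is then a
      hit within the dyadic horizon, or is a far mistake.\<close>
    have sub: "{t. t < T \<and> nn_mistake c nn ?xs t} \<subseteq> ?N \<union> ?F" using K(1) by auto
    have "?N \<subseteq> {..<nat \<lceil>2 powr (real K * (d + 1))\<rceil>}" by (auto; linarith)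
    then have "finite (?N \<union> ?F)" using B(2)[OF nn, of ?xs K] finite_subset by blast
    then have "card {t. t < T \<and> nn_mistake c nn ?xs t} \<le> card (?N \<union> ?F)" using sub by (rule card_mono)
    also have "\<dots> \<le> card ?N + card ?F" by (rule card_Un_le)
    finally have "real (num_mistakes c nn ?xs T) \<le> real (card ?N) + real (card ?F)"
      unfolding num_mistakes_def by linarith
    also have "\<dots> \<le> A * 2 powr (real K * ?q) + B * 2 powr (real K * ?q)"
      using hits[OF \<omega>] B(2)[OF nn] by (intro add_mono) blast+
    also have "\<dots> = (A + B) * 2 powr (real K * ?q)" by (simp add: algebra_simps)
    also have "2 powr (real K * ?q) = (2 powr (real K * (d + 1))) powr ?e"
      using assms(11) by (simp add: powr_powr)
    also have "\<dots> \<le> (2 powr (d + 1) * real T) powr ?e"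
      using K(2) assms(11,13) by (intro powr_mono2) auto
    also have "\<dots> = 2 powr ?q * real T powr ?e" using assms(11) by (simp add: powr_mult powr_powr)
    also have "real T powr ?e = b powr - ?e * (b * real T) powr ?e"
      using b by (simp add: powr_mult powr_minus)
    finally have "real (num_mistakes c nn ?xs T) \<le> C1 * (b * real T) powr ?e"
      unfolding C1_def using A B(1) by (simp add: mult_left_mono mult.assoc)
    then show ?thesis unfolding b_def by simp
  qed
  ultimately show ?thesis using E by (intro exI[of _ 1] exI[of _ C1]) auto
qed

end
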